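(* Let $M>1$, $\mathcal R=[1/M,M]$, $\hat x\in\mathcal R$, $\delta\in(0,1)$, and let $D=\{x\in\mathcal R:\ 1-\delta\le x/\hat x\le1+\delta\}$. Let $\phi_3(t,x)=\dfrac{x/\hat x-1}{2+(t+1)(x/\hat x-1)}$ and put $$\rho=\frac{2-\delta}{\delta},\qquad L=\left(\frac{2-\delta}{\delta}-\frac{\rho}{2}-\frac{\rho^{-1}}{2}\right)^{-1}.$$ Then $|\phi_3(z,x)|\le L$ for all $x\in D$ and all $z=\frac{\rho}{2}e^{i\theta}+\frac{\rho^{-1}}{2}e^{-i\theta}$, $\theta\in[0,2\pi]$. Moreover, for every $\epsilon>0$ one can choose a number of points $$N=O\left(\frac{\log(1-\delta)}{\log(\delta)}+\frac{\log(\epsilon)}{\log(\delta)}\right)$$ such that, restricted to $x\in D$, $$\operatorname{hyp}\log(-\epsilon)\subseteq\hat H_{\phi_3,N}\subseteq\operatorname{hyp}\log(\epsilon),$$ where, with $\{t_k\}_{k\in[N]}$, $\{w_k\}_{k\in[N]}$ the nodes and weights of $N$-point Gaussian quadrature on $[-1,1]$, $\hat H_{\phi_3,N}$ is the set of $(x,\nu)\in\mathcal R\times\mathbb R$ for which there exist $v_k,r_{1k},r_{2k}\in\mathbb R$ ($k\in[N]$) with $$\sum_{k\in[N]}w_kv_k\ge\nu-\log(\hat x),$$ $$r_{1k}=1-(t_k+1)v_k\ge0,\quad r_{2k}=(x/\hat x-1)-2v_k\ge0,\quad \big(v_k\sqrt{8(t_k+1)},\,r_{1k}-r_{2k},\,r_{1k}+r_{2k}\big)\in\mathcal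 L_3\quad\forall k\in[N].$$ In particular $\hat H_{\phi_3,N}$ is represented with $O(\log(1-\delta)/\log(\delta)+\log(\epsilon)/\log(\delta))$ variables and second-order conic constraints.
   Context: $[N]=\{1,\dots,N\}$; $\mathcal L_3=\{y\in\mathbb R^3:y_3\ge\sqrt{y_1^2+y_2^2}\}$; for $\alpha\in\mathbb R$, $\operatorname{hyp}\log(\alpha)=\{(x,\nu)\in\mathcal R\times\mathbb R:\log(x)\ge\nu-\alpha\}$. "Restricted to $x\in D$" means that each of the sets is intersected with $D\times\mathbb R$. Gaussian quadrature is Gauss–Legendre quadrature. $O(\cdot)$ is the usual asymptotic notation (as $\epsilon\to0$). *)

theory Defs
  imports "HOL-Analysis.Analysis" "HOL-Computational_Algebra.Polynomial"
    "HOL-Library.Landau_Symbols"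
begin

section \<open>Gauss--Legendre quadrature on [-1, 1]\<close>

text \<open>Rodrigues' formula.\<close>

definition legendre_poly :: "nat \<Rightarrow> real poly" where
  "legendre_poly N = smult (1 / (2 ^ N * fact N)) ((pderiv ^^ N) ([:-1, 0, 1:] ^ N))"

text \<open>The nodes are the roots of the Legendre polynomial in increasing order, indexed from 1 to
  \<^term>\<open>N\<close>; the weights are those of the interpolatory rule on these nodes, that is,
  the integrals of the Lagrange basis polynomials.\<close>

definition gauss_node :: "nat \<Rightarrow> nat \<Rightarrow> real" where
  "gauss_node N k = sorted_list_of_set {t. poly (legendre_poly N) t = 0} ! (k - 1)"

definition gauss_weight :: "nat \<Rightarrow> nat \<Rightarrow> real" where
  "gauss_weight N k = integral {-1..1}
     (\<lambda>t. \<Prod>j\<in>{1..N} - {k}. (t - gauss_node N j) / (gauss_node N k - gauss_node N j))"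

section \<open>Second-order cone representations\<close>

definition lorentz3 :: "(real \<times> real \<times> real) set" where
  "lorentz3 = {(y1, y2, y3). y3 \<ge> sqrt (y1\<^sup>2 + y2\<^sup>2)}"

text \<open>An affine form \<open>(a, b)\<close> on \<open>\<real>\<^sup>n\<close> stands for
  \<open>y \<mapsto> a\<^sub>0 y\<^sub>0 + \<dots> + a\<^sub>n\<^sub>-\<^sub>1 y\<^sub>n\<^sub>-\<^sub>1 + b\<close>.\<close>

type_synonym affine_form = "(nat \<Rightarrow> real) \<times> real"

definition affine_val :: "nat \<Rightarrow> affine_form \<Rightarrow> (nat \<Rightarrow> real) \<Rightarrow> real" where
  "affine_val n f y = (\<Sum>i<n. fst f i * y i) + snd f"

datatype soc_constraint =
    Lin_eq affine_form
  | Lin_ge affine_form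
  | Soc affine_form affine_form affine_form

fun satisfies :: "nat \<Rightarrow> (nat \<Rightarrow> real) \<Rightarrow> soc_constraint \<Rightarrow> bool" where
  "satisfies n y (Lin_eq f) \<longleftrightarrow> affine_val n f y = 0"
| "satisfies n y (Lin_ge f) \<longleftrightarrow> affine_val n f y \<ge> 0"
| "satisfies n y (Soc f g h) \<longleftrightarrow>
     (affine_val n f y, affine_val n g y, affine_val n h y) \<in> lorentz3"

text \<open>\<open>S\<close> is the projection to the first two coordinates of the solution set in \<open>\<real>\<^sup>n\<close> of \<open>m\<close>
  constraints. All variables are counted, including the two coordinates of the points of
  \<open>S\<close>, and so are the linear constraints.\<close>

definition soc_represented :: "(real \<times> real) set \<Rightarrow> nat \<Rightarrow> nat \<Rightarrow> bool" where
  "soc_represented S n m \<longleftrightarrow> n \<ge> 2 \<and>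
     (\<exists>cs. length cs = m \<and>
       S = {(x, \<nu>). \<exists>y. y 0 = x \<and> y 1 = \<nu> \<and> (\<forall>c\<in>set cs. satisfies n y c)})"

section \<open>The hypograph of the logarithm and its approximation\<close>

definition hyp_log :: "real \<Rightarrow> real \<Rightarrow> (real \<times> real) set" where
  "hyp_log M \<alpha> = {(x, \<nu>). x \<in> {1/M..M} \<and> ln x \<ge> \<nu> - \<alpha>}"

definition dom_near :: "real \<Rightarrow> real \<Rightarrow> real \<Rightarrow> real set" where
  "dom_near M xh \<delta> = {x \<in> {1/M..M}. 1 - \<delta> \<le> x / xh \<and> x / xh \<le> 1 + \<delta>}"

definition phi3_denom :: "real \<Rightarrow> complex \<Rightarrow> real \<Rightarrow> complex" where
  "phi3_denom xh t x = 2 + (t + 1) * of_real (x / xh - 1)"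

definition phi3 :: "real \<Rightarrow> complex \<Rightarrow> real \<Rightarrow> complex" where
  "phi3 xh t x = of_real (x / xh - 1) / phi3_denom xh t x"

definition rho :: "real \<Rightarrow> real" where
  "rho \<delta> = (2 - \<delta>) / \<delta>"

definition phi3_bound :: "real \<Rightarrow> real" where
  "phi3_bound \<delta> = inverse ((2 - \<delta>) / \<delta> - rho \<delta> / 2 - inverse (rho \<delta>) / 2)"

definition H_hat :: "real \<Rightarrow> real \<Rightarrow> nat \<Rightarrow> (real \<times> real) set" where
  "H_hat M xh N = {(x, \<nu>). x \<in> {1/M..M} \<and>
     (\<exists>v r1 r2 :: nat \<Rightarrow> real.
        (\<Sum>k=1..N. gauss_weight N k * v k) \<ge> \<nu> - ln xh \<and>
        (\<forall>k\<in>{1..N}.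
           r1 k = 1 - (gauss_node N k + 1) * v k \<and> r1 k \<ge> 0 \<and>
           r2 k = (x / xh - 1) - 2 * v k \<and> r2 k \<ge> 0 \<and>
           (v k * sqrt (8 * (gauss_node N k + 1)), r1 k - r2 k, r1 k + r2 k) \<in> lorentz3))}"

definition size_rate :: "real \<Rightarrow> real \<Rightarrow> real" where
  "size_rate \<delta> \<epsilon> = ln (1 - \<delta>) / ln \<delta> + ln \<epsilon> / ln \<delta>"

end

theory Submission
  imports Defs
begin

text \<open>
  Write \<open>s = x / xh - 1\<close>. The conic constraints say exactly \<open>v\<^sub>k \<le> \<phi>\<^sub>3(t\<^sub>k, x)\<close>, and the Gauss weights
  are nonnegative, so \<open>H_hat\<close> is the hypograph of \<open>ln xh\<close> plus the Gauss quadrature of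
  \<open>\<phi>\<^sub>3(\<cdot>, x)\<close>, whose exact integral is \<open>ln (1 + s)\<close>. As \<open>\<phi>\<^sub>3(t, x) = c / (1 + c t)\<close> with
  \<open>\<bar>c\<bar> \<le> \<delta>\<close>, the geometric series truncated at degree \<open>2 N - 1\<close>, where the quadrature is exact, has
  error at most \<open>\<delta>\<^bsup>2N+1\<^esup> / (1 - \<delta>)\<close> on \<open>[-1, 1]\<close>; the quadrature error is then at most four times this.
  Hence \<open>N \<ge> size_rate \<delta> (\<epsilon> / 4)\<close> points suffice, and for \<open>\<epsilon> < 1/4\<close> this is at most
  \<open>2 size_rate \<delta> \<epsilon>\<close>.
\<close>

section \<open>Legendre polynomials\<close>

lemma power_dvd_pderiv:
  fixes r p :: "'a :: {comm_ring_1, ring_no_zero_divisors} poly"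
  assumes "r ^ Suc n dvd p"
  shows "r ^ n dvd pderiv p"
proof -
  obtain c where "p = r ^ Suc n * c"
    using assms by (rule dvdE)
  then have "pderiv p = r ^ n * (r * pderiv c + smult (of_nat (Suc n)) (pderiv r * c))"
    by (simp add: pderiv_mult pderiv_power_Suc algebra_simps del: of_nat_Suc power_Suc)
       (simp add: algebra_simps)
  then show ?thesis by simp
qed

lemma power_dvd_higher_pderiv:
  fixes r :: "'a :: {comm_ring_1, ring_no_zero_divisors} poly"
  assumes "k \<le> N"
  shows "r ^ (N - k) dvd (pderiv ^^ k) (r ^ N)"
  using assms
proof (induction k)
  case (Suc k)
  then have "r ^ Suc (N - Suc k) dvd (pderiv ^^ k) (r ^ N)"
    by (simp add: Suc_diff_Suc del: power_Suc)
  then show ?case using power_dvd_pderiv by fastforce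
qed simp

text \<open>Each differentiation of a power removes at most one factor \<open>r\<close>, so one
  remains while \<open>k < N\<close>. For \<open>[:-1, 0, 1:]\<close> this makes both end points of
  [-1, 1] roots, which serves Rolle's theorem and integration by parts alike.\<close>

lemma higher_pderiv_power_root:
  fixes r :: "'a :: {comm_ring_1, ring_no_zero_divisors} poly"
  assumes "k < N" "poly r a = 0"
  shows "poly ((pderiv ^^ k) (r ^ N)) a = 0"
proof -
  obtain c where "(pderiv ^^ k) (r ^ N) = r ^ (N - k) * c"
    using power_dvd_higher_pderiv[of k N r] assms by (auto elim: dvdE)
  then show ?thesis using assms by (simp add: zero_power)
qed

section \<open>Number and location of the Legendre roots\<close>

text \<open>Rolle's theorem between consecutive roots. A new largest point adds a zero of the
  derivative to the right of \<open>Max A\<close>; the bound by \<open>Min S\<close> and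
  \<open>Max S\<close> in the claim shows that this zero is not yet in \<open>T\<close>.\<close>

lemma rolle_finite_root_set:
  fixes p :: "real poly"
  assumes "finite S" "S \<noteq> {}" "\<And>x. x \<in> S \<Longrightarrow> poly p x = 0"
  shows "\<exists>T. finite T \<and> Suc (card T) = card S \<and> T \<subseteq> {Min S<..<Max S} \<and>
           (\<forall>x\<in>T. poly (pderiv p) x = 0)"
  using assms
proof (induction S rule: finite_linorder_max_induct)
  case (insert b A)
  show ?case
  proof (cases "A = {}")
    case True
    then show ?thesis by (intro exI[of _ "{}"]) auto
  next
    case False
    then obtain T where T: "finite T" "Suc (card T) = card A" "T \<subseteq> {Min A<..<Max A}"
        "\<forall>x\<in>T. poly (pderiv p) x = 0"
      using insert by auto
    have mx: "Max A \<in> A" and mn: "Min A \<in> A" using False insert by auto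
    have "Max A < b" using mx insert by auto
    moreover have "poly p (Max A) = poly p b" using mx insert by auto
    ultimately obtain z where z: "Max A < z" "z < b" "poly (pderiv p) z = 0"
      using poly_MVT[of "Max A" b p] by auto
    have "Min A \<le> Max A" using mn insert by simp
    have "Max (insert b A) = b"
      using False \<open>finite A\<close> \<open>Max A < b\<close> by (subst Max_insert) linarith+
    moreover have "Min (insert b A) = Min A"
      using False \<open>finite A\<close> \<open>Max A < b\<close> \<open>Min A \<le> Max A\<close> by (subst Min_insert) linarith+
    moreover have "z \<notin> T" using T z by auto
    moreover have "b \<notin> A" using insert by auto
    ultimately show ?thesis
      using T z insert \<open>Max A < b\<close> \<open>Min A \<le> Max A\<close>
      by (intro exI[of _ "insert z T"]) force
  qed
qed simp

text \<open>As long as \<open>k < N\<close>, the \<open>k\<close>-th derivative vanishes at -1 and 1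
  besides its \<open>k\<close> interior roots. Rolle on these \<open>k + 2\<close> points gives the
  \<open>k + 1\<close> interior roots of the next derivative.\<close>

lemma rodrigues_roots:
  assumes "k \<le> N"
  shows "\<exists>T. finite T \<and> card T = k \<and> T \<subseteq> {-1<..<1::real} \<and>
           (\<forall>x\<in>T. poly ((pderiv ^^ k) ([:-1, 0, 1:] ^ N)) x = 0)"
  using assms
proof (induction k)
  case (Suc k)
  then obtain T where T: "finite T" "card T = k" "T \<subseteq> {-1<..<1::real}"
      "\<forall>x\<in>T. poly ((pderiv ^^ k) ([:-1, 0, 1:] ^ N)) x = 0"
    by auto
  define S where "S = insert (-1) (insert 1 T)"
  have fS: "finite S" "S \<noteq> {}" "S \<subseteq> {-1..1}" using T by (auto simp: S_def)
  have "card S = Suc (Suc k)" using T by (auto simp: S_def card_insert_if)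
  moreover have "poly ((pderiv ^^ k) ([:-1, 0, 1:] ^ N)) x = 0" if "x \<in> S" for x
    using that T(4) higher_pderiv_power_root[of k N "[:-1, 0, 1:]" x] Suc.prems by (auto simp: S_def)
  moreover have "{Min S<..<Max S} \<subseteq> {-1<..<1}"
  proof -
    have "Min S \<ge> -1" "Max S \<le> 1" using fS by auto
    then show ?thesis by auto
  qed
  ultimately show ?case
    using rolle_finite_root_set[of S "(pderiv ^^ k) ([:-1, 0, 1:] ^ N)"] fS by force
qed auto

lemma degree_higher_pderiv:
  fixes p :: "'a :: {comm_semiring_1, semiring_no_zero_divisors, semiring_char_0} poly"
  shows "degree ((pderiv ^^ k) p) = degree p - k"
  by (induction k) (auto simp: degree_pderiv)

lemma degree_legendre_poly [simp]: "degree (legendre_poly N) = N"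
proof -
  have "degree ([:-1, 0, 1:] ^ N :: real poly) = 2 * N"
    by (simp add: degree_power_eq)
  then show ?thesis
    unfolding legendre_poly_def by (simp add: degree_higher_pderiv)
qed

lemma legendre_poly_nonzero [simp]: "legendre_poly N \<noteq> 0"
proof (cases "N = 0")
  case True
  then show ?thesis by (simp add: legendre_poly_def)
next
  case False
  then show ?thesis by (metis degree_0 degree_legendre_poly)
qed

definition legendre_roots :: "nat \<Rightarrow> real set" where
  "legendre_roots N = {t. poly (legendre_poly N) t = 0}"

lemma finite_legendre_roots [simp]: "finite (legendre_roots N)"
  by (simp add: legendre_roots_def poly_roots_finite)

text \<open>The \<open>N\<close> interior roots found by Rolle exhaust the root set, because the
  degree is \<open>N\<close>.\<close>

lemma legendre_roots_bounds_card:
  "legendre_roots N \<subseteq> {-1<..<1} \<and> card (legendre_roots N) = N"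
proof -
  obtain T where T: "finite T" "card T = N" "T \<subseteq> {-1<..<1::real}"
      "\<forall>x\<in>T. poly ((pderiv ^^ N) ([:-1, 0, 1:] ^ N)) x = 0"
    using rodrigues_roots[of N N] by auto
  have sub: "T \<subseteq> legendre_roots N"
    using T by (auto simp: legendre_roots_def legendre_poly_def)
  have "card (legendre_roots N) \<le> N"
    using card_poly_roots_bound[of "legendre_poly N"] by (simp add: legendre_roots_def)
  then have "T = legendre_roots N"
    using sub T by (intro card_seteq) auto
  then show ?thesis using T by simp
qed

text \<open>The sorted list of roots has length exactly \<open>N\<close>, so every access
  \<open>k - 1\<close> with \<open>k\<close> in \<open>{1..N}\<close> is in range.\<close>

lemma bij_betw_gauss_node: "bij_betw (gauss_node N) {1..N} (legendre_roots N)"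
proof -
  have "bij_betw ((!) (sorted_list_of_set (legendre_roots N))) {..<N} (legendre_roots N)"
    by (rule bij_betw_nth) (use legendre_roots_bounds_card[of N] in auto)
  moreover have "bij_betw (\<lambda>k. k - 1) {1..N} {..<N}"
    by (rule bij_betwI[where g = Suc]) auto
  ultimately have "bij_betw ((!) (sorted_list_of_set (legendre_roots N)) \<circ> (\<lambda>k. k - 1)) {1..N} (legendre_roots N)"
    by (rule bij_betw_trans[rotated])
  then show ?thesis
    by (rule bij_betw_cong[THEN iffD1, rotated]) (simp add: gauss_node_def legendre_roots_def)
qed

lemma gauss_node_bounds:
  assumes "k \<in> {1..N}"
  shows "-1 < gauss_node N k" "gauss_node N k < 1"
proof -
  have "gauss_node N k \<in> {-1<..<1}"
    using bij_betw_apply[OF bij_betw_gauss_node assms] legendre_roots_bounds_card[of N] by blast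
  then show "-1 < gauss_node N k" "gauss_node N k < 1" by auto
qed

lemma gauss_node_eq_iff:
  assumes "j \<in> {1..N}" "k \<in> {1..N}"
  shows "gauss_node N j = gauss_node N k \<longleftrightarrow> j = k"
  using inj_on_eq_iff[OF bij_betw_imp_inj_on[OF bij_betw_gauss_node]] assms .

lemma poly_legendre_gauss_node:
  assumes "k \<in> {1..N}"
  shows "poly (legendre_poly N) (gauss_node N k) = 0"
proof -
  have "gauss_node N k \<in> legendre_roots N"
    using bij_betw_gauss_node[of N] assms by (rule bij_betw_apply)
  then show ?thesis by (simp add: legendre_roots_def)
qed

section \<open>Orthogonality to polynomials of lower degree\<close>

lemma poly_integrable [simp]: "poly p integrable_on {a..b :: real}"
  by (intro integrable_continuous_real continuous_intros)

lemma integral_pderiv: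
  fixes p :: "real poly"
  assumes "a \<le> b"
  shows "integral {a..b} (poly (pderiv p)) = poly p b - poly p a"
  using assms
  by (intro integral_unique fundamental_theorem_of_calculus)
     (auto simp: has_real_derivative_iff_has_vector_derivative[symmetric]
           intro: DERIV_subset[OF poly_DERIV])

text \<open>Integration by parts moves the derivatives one at a time onto \<open>q\<close>; the
  boundary terms vanish since the lower derivatives are zero at -1 and 1.\<close>

lemma rodrigues_orthogonal:
  assumes "k \<le> N" "degree q < k"
  shows "integral {-1..1::real} (poly ((pderiv ^^ k) ([:-1, 0, 1:] ^ N) * q)) = 0"
  using assms
proof (induction k arbitrary: q)
  case (Suc k)
  define u where "u = (pderiv ^^ k) ([:-1, 0, 1:] ^ N :: real poly)"
  have "poly u 1 = 0" "poly u (-1) = 0"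
    using Suc.prems by (auto simp: u_def intro!: higher_pderiv_power_root)
  then have "integral {-1..1} (poly (pderiv (u * q))) = 0"
    by (subst integral_pderiv) auto
  moreover have "poly (pderiv u * q) = (\<lambda>t. poly (pderiv (u * q)) t - poly (u * pderiv q) t)"
    by (auto simp: pderiv_mult algebra_simps)
  ultimately have "integral {-1..1} (poly (pderiv u * q)) = - integral {-1..1} (poly (u * pderiv q))"
    by (simp add: integral_diff del: poly_mult)
  also have "integral {-1..1} (poly (u * pderiv q)) = 0"
  \<comment> \<open>For constant \<open>q\<close> the degree does not drop, so for
    \<open>k = 0\<close> the induction hypothesis would not apply; the derivative is zero
    instead.\<close>
  proof (cases "degree q = 0")
    case True
    then have "pderiv q = 0" by (simp add: pderiv_eq_0_iff)
    then show ?thesis by (simp add: poly_0[abs_def])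
  next
    case False
    then show ?thesis
      using Suc.IH[of "pderiv q"] Suc.prems by (simp add: u_def degree_pderiv del: poly_mult)
  qed
  finally show ?case by (simp add: u_def)
qed simp

lemma legendre_orthogonal:
  assumes "degree q < N"
  shows "integral {-1..1} (poly (legendre_poly N * q)) = 0"
proof -
  have "poly (legendre_poly N * q) =
      (\<lambda>t. (1 / (2 ^ N * fact N)) *\<^sub>R poly ((pderiv ^^ N) ([:-1, 0, 1:] ^ N) * q) t)"
    by (auto simp: legendre_poly_def)
  then show ?thesis
    using rodrigues_orthogonal[OF order_refl assms] by (simp only: integral_cmul scaleR_zero_right)
qed

section \<open>Gauss--Legendre quadrature\<close>

definition lagrange_basis :: "nat \<Rightarrow> nat \<Rightarrow> real poly" where
  "lagrange_basis N k = (\<Prod>j\<in>{1..N} - {k}.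
     smult (1 / (gauss_node N k - gauss_node N j)) [:- gauss_node N j, 1:])"

lemma gauss_weight_eq: "gauss_weight N k = integral {-1..1} (poly (lagrange_basis N k))"
  unfolding gauss_weight_def lagrange_basis_def
  by (intro arg_cong[where f = "integral _"] ext) (simp add: poly_prod diff_divide_distrib)

lemma degree_lagrange_basis:
  assumes "k \<in> {1..N}"
  shows "degree (lagrange_basis N k) < N"
proof -
  have "degree (lagrange_basis N k) \<le> (\<Sum>j\<in>{1..N} - {k}.
      degree (smult (1 / (gauss_node N k - gauss_node N j)) [:- gauss_node N j, 1:]))"
    unfolding lagrange_basis_def by (rule degree_prod_sum_le[THEN order_trans]) auto
  also have "\<dots> \<le> (\<Sum>j\<in>{1..N} - {k}. 1)"
    by (intro sum_mono order_trans[OF degree_smult_le]) simp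
  also have "\<dots> < N" using assms by simp
  finally show ?thesis .
qed

lemma lagrange_basis_node:
  assumes "j \<in> {1..N}" "k \<in> {1..N}"
  shows "poly (lagrange_basis N k) (gauss_node N j) = (if j = k then 1 else 0)"
  using assms by (auto simp: lagrange_basis_def poly_prod gauss_node_eq_iff
      simp flip: diff_divide_distrib intro!: prod.neutral)

text \<open>Both sides have degree below \<open>N\<close> and agree at the \<open>N\<close> nodes,
  so their difference has too many roots to be nonzero.\<close>

lemma lagrange_interpolation:
  assumes "degree r < N"
  shows "r = (\<Sum>k=1..N. smult (poly r (gauss_node N k)) (lagrange_basis N k))" (is "_ = ?s")
proof -
  have ds: "degree ?s < N"
    using assms by (intro degree_sum_less le_less_trans[OF degree_smult_le] degree_lagrange_basis) auto
  have root: "poly (r - ?s) t = 0" if "t \<in> legendre_roots N" for t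
  proof -
    have "t \<in> gauss_node N ` {1..N}"
      using that by (simp only: bij_betw_imp_surj_on[OF bij_betw_gauss_node])
    then obtain j where j: "j \<in> {1..N}" "t = gauss_node N j"
      by (elim imageE)
    have "poly ?s t = (\<Sum>k=1..N. if k = j then poly r (gauss_node N k) else 0)"
      unfolding poly_sum by (rule sum.cong) (use j in \<open>auto simp: lagrange_basis_node\<close>)
    then show ?thesis using j(1) by (simp add: j(2))
  qed
  have "r - ?s = 0"
  proof (rule ccontr)
    assume nz: "r - ?s \<noteq> 0"
    have "N = card (legendre_roots N)" using legendre_roots_bounds_card by simp
    also have "\<dots> \<le> card {t. poly (r - ?s) t = 0}"
      using root nz by (intro card_mono poly_roots_finite) auto
    also have "\<dots> \<le> degree (r - ?s)" using nz by (rule card_poly_roots_bound)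
    also have "\<dots> < N" using assms ds by (rule degree_diff_less)
    finally show False by simp
  qed
  then show ?thesis by simp
qed

section \<open>Exactness, positive weights and the quadrature error\<close>

lemma gauss_quadrature_exact_low:
  assumes "degree r < N"
  shows "integral {-1..1} (poly r) = (\<Sum>k=1..N. gauss_weight N k * poly r (gauss_node N k))"
proof -
  have "poly r = (\<lambda>t. \<Sum>k=1..N. poly r (gauss_node N k) * poly (lagrange_basis N k) t)"
    by (subst (1) lagrange_interpolation[OF assms]) (simp add: poly_sum fun_eq_iff)
  then have "integral {-1..1} (poly r) =
      integral {-1..1} (\<lambda>t. \<Sum>k=1..N. poly r (gauss_node N k) * poly (lagrange_basis N k) t)"
    by simp
  also have "\<dots> = (\<Sum>k=1..N. integral {-1..1} (\<lambda>t. poly r (gauss_node N k) * poly (lagrange_basis N k) t))"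
    by (intro integral_sum) (auto intro!: integrable_on_mult_right)
  also have "\<dots> = (\<Sum>k=1..N. gauss_weight N k * poly r (gauss_node N k))"
    by (simp add: gauss_weight_eq mult.commute)
  finally show ?thesis .
qed

text \<open>Divide by the Legendre polynomial. The quotient has degree below \<open>N\<close>, so
  its term integrates to zero by orthogonality and also vanishes at the nodes; the remainder is
  covered by interpolation.\<close>

theorem gauss_quadrature_exact:
  assumes "degree p < 2 * N"
  shows "integral {-1..1} (poly p) = (\<Sum>k=1..N. gauss_weight N k * poly p (gauss_node N k))"
proof -
  define q r where "q = p div legendre_poly N" and "r = p mod legendre_poly N"
  have p: "p = legendre_poly N * q + r" by (simp add: q_def r_def)
  have dr: "degree r < N"
    using degree_mod_less[of "legendre_poly N" p] assms by (auto simp: r_def)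
  have dq: "degree q < N"
  proof (cases "q = 0")
    case False
    then have "degree (legendre_poly N * q) = N + degree q"
      by (simp add: degree_mult_eq)
    moreover have "degree (legendre_poly N * q) < 2 * N"
      using degree_diff_less[OF assms, of r] dr by (simp add: p)
    ultimately show ?thesis by simp
  qed (use assms in auto)
  have "poly p = (\<lambda>t. poly (legendre_poly N * q) t + poly r t)"
    by (subst p) auto
  then have "integral {-1..1} (poly p) = integral {-1..1} (poly r)"
    using legendre_orthogonal[OF dq] by (simp add: integral_add del: poly_mult)
  also have "\<dots> = (\<Sum>k=1..N. gauss_weight N k * poly r (gauss_node N k))"
    by (rule gauss_quadrature_exact_low[OF dr])
  also have "\<dots> = (\<Sum>k=1..N. gauss_weight N k * poly p (gauss_node N k))"
    by (rule sum.cong) (simp_all add: p poly_legendre_gauss_node)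
  finally show ?thesis .
qed

text \<open>The square of a Lagrange basis polynomial has degree below \<open>2 * N\<close>, and the
  rule applied to it returns exactly one weight, which is thus the integral of a square.\<close>

lemma gauss_weight_nonneg:
  assumes "k \<in> {1..N}"
  shows "gauss_weight N k \<ge> 0"
proof -
  let ?l = "lagrange_basis N k"
  have "degree (?l * ?l) \<le> degree ?l + degree ?l" by (rule degree_mult_le)
  then have "degree (?l * ?l) < 2 * N"
    using degree_lagrange_basis[OF assms] by linarith
  then have "integral {-1..1} (poly (?l * ?l)) =
      (\<Sum>j=1..N. gauss_weight N j * poly (?l * ?l) (gauss_node N j))"
    by (rule gauss_quadrature_exact)
  also have "\<dots> = (\<Sum>j=1..N. if j = k then gauss_weight N j else 0)"
    by (rule sum.cong) (use assms in \<open>auto simp: lagrange_basis_node\<close>)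
  also have "\<dots> = gauss_weight N k" using assms by simp
  finally have "gauss_weight N k = integral {-1..1} (poly (?l * ?l))" by simp
  also have "\<dots> \<ge> 0" by (rule integral_nonneg) auto
  finally show ?thesis .
qed

lemma sum_gauss_weight:
  assumes "N \<ge> 1"
  shows "(\<Sum>k=1..N. gauss_weight N k) = 2"
  using gauss_quadrature_exact[of 1 N] assms by (simp add: poly_1[abs_def])

text \<open>The integral and the quadrature rule are positive functionals of total mass 2 that agree
  on \<open>p\<close>. Replacing \<open>f\<close> by \<open>p\<close> changes each by at most
  \<open>2 * e\<close>.\<close>

lemma gauss_quadrature_error:
  assumes "N \<ge> 1" "degree p < 2 * N" "f integrable_on {-1..1}"
    and e: "\<And>t. t \<in> {-1..1} \<Longrightarrow> \<bar>f t - poly p t\<bar> \<le> e"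
  shows "\<bar>(\<Sum>k=1..N. gauss_weight N k * f (gauss_node N k)) - integral {-1..1} f\<bar> \<le> 4 * e"
proof -
  have "\<bar>integral {-1..1} (\<lambda>t. f t - poly p t)\<bar> \<le> integral {-1..1::real} (\<lambda>t. e)"
    using integral_norm_bound_integral[of "\<lambda>t. f t - poly p t" "{-1..1}" "\<lambda>t. e"] assms
    by (simp add: integrable_diff integrable_const_ivl)
  then have I: "\<bar>integral {-1..1} f - integral {-1..1} (poly p)\<bar> \<le> 2 * e"
    using assms by (simp add: integral_diff)
  let ?Q = "\<lambda>g. \<Sum>k=1..N. gauss_weight N k * g (gauss_node N k)"
  have "\<bar>?Q f - ?Q (poly p)\<bar> = \<bar>\<Sum>k=1..N. gauss_weight N k * (f (gauss_node N k) - poly p (gauss_node N k))\<bar>"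
    by (simp add: sum_subtractf right_diff_distrib)
  also have "\<dots> \<le> (\<Sum>k=1..N. gauss_weight N k * e)"
  proof (rule order_trans[OF sum_abs sum_mono])
    fix k assume k: "k \<in> {1..N}"
    have "\<bar>f (gauss_node N k) - poly p (gauss_node N k)\<bar> \<le> e"
      using gauss_node_bounds[OF k] by (intro e) auto
    then show "\<bar>gauss_weight N k * (f (gauss_node N k) - poly p (gauss_node N k))\<bar> \<le> gauss_weight N k * e"
      using gauss_weight_nonneg[OF k] by (simp add: abs_mult mult_left_mono)
  qed
  also have "\<dots> = 2 * e"
    using sum_gauss_weight[OF assms(1)] by (simp flip: sum_distrib_right)
  finally show ?thesis
    using I gauss_quadrature_exact[OF assms(2)] by linarith
qed

section \<open>Quadrature of the logarithm\<close>

lemma has_integral_log_kernel: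
  fixes c :: real
  assumes "\<bar>c\<bar> < 1"
  shows "((\<lambda>t. c / (1 + c * t)) has_integral ln ((1 + c) / (1 - c))) {-1..1}"
proof -
  have pos: "1 + c * t > 0" if "t \<in> {-1..1}" for t
  proof -
    have "\<bar>c * t\<bar> \<le> \<bar>c\<bar>" using that by (simp add: abs_mult mult_left_le abs_le_iff)
    then show ?thesis using assms by linarith
  qed
  have "((\<lambda>t. c / (1 + c * t)) has_integral ln (1 + c * 1) - ln (1 + c * (-1))) {-1..1}"
  proof (rule fundamental_theorem_of_calculus)
    fix t :: real assume "t \<in> {-1..1}"
    then show "((\<lambda>t. ln (1 + c * t)) has_vector_derivative c / (1 + c * t)) (at t within {-1..1})"
      unfolding has_real_derivative_iff_has_vector_derivative[symmetric]
      using pos[of t] by (auto intro!: derivative_eq_intros)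
  qed simp
  then show ?thesis using assms by (simp add: ln_div)
qed

text \<open>The first \<open>n\<close> terms of the geometric series of
  \<open>c / (1 + c * t)\<close> in powers of \<open>t\<close>.\<close>

definition log_kernel_poly :: "nat \<Rightarrow> real \<Rightarrow> real poly" where
  "log_kernel_poly n c = (\<Sum>k<n. monom (c * (- c) ^ k) k)"

lemma degree_log_kernel_poly:
  assumes "n > 0"
  shows "degree (log_kernel_poly n c) < n"
  unfolding log_kernel_poly_def
  using assms by (intro degree_sum_less le_less_trans[OF degree_monom_le]) auto

lemma log_kernel_poly_error:
  assumes "\<bar>c\<bar> \<le> \<delta>" "\<delta> < 1" "\<bar>t\<bar> \<le> 1"
  shows "\<bar>c / (1 + c * t) - poly (log_kernel_poly n c) t\<bar> \<le> \<delta> ^ Suc n / (1 - \<delta>)"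
proof -
  have ct: "\<bar>c * t\<bar> \<le> \<bar>c\<bar>" using assms by (simp add: abs_mult mult_left_le)
  then have pos: "1 + c * t \<ge> 1 - \<delta>" using assms by linarith
  have "poly (log_kernel_poly n c) t = c * (\<Sum>k<n. (- (c * t)) ^ k)"
    unfolding log_kernel_poly_def poly_sum sum_distrib_left
    by (rule sum.cong) (simp_all add: poly_monom flip: power_mult_distrib)
  moreover have "(1 + c * t) * (\<Sum>k<n. (- (c * t)) ^ k) = 1 - (- (c * t)) ^ n"
    using one_diff_power_eq[of "- (c * t)" n] by simp
  \<comment> \<open>The exact remainder of the geometric series; its denominator is at least
    \<open>1 - \<delta>\<close>.\<close>
  ultimately have "c / (1 + c * t) - poly (log_kernel_poly n c) t = c * (- (c * t)) ^ n / (1 + c * t)"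
    using pos assms by (simp add: field_simps) (simp flip: distrib_left distrib_right)
  also have "\<bar>\<dots>\<bar> = \<bar>c\<bar> * \<bar>c * t\<bar> ^ n / (1 + c * t)"
    using pos assms by (simp add: abs_mult power_abs)
  also have "\<dots> \<le> \<delta> * \<delta> ^ n / (1 - \<delta>)"
    using pos ct assms by (intro frac_le mult_mono power_mono) auto
  finally show ?thesis by simp
qed

text \<open>With \<open>c = s / (2 + s)\<close> the integrand \<open>s / (2 + (t + 1) s)\<close> becomes \<open>c / (1 + c t)\<close>, and
  \<open>\<bar>s\<bar> \<le> \<delta>\<close> gives \<open>\<bar>c\<bar> \<le> \<delta> / (2 - \<delta>) = 1 / \<rho> \<le> \<delta>\<close>.\<close>

lemma gauss_log_error:
  assumes "N \<ge> 1" "\<bar>s\<bar> \<le> \<delta>" "\<delta> < 1"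
  shows "\<bar>(\<Sum>k=1..N. gauss_weight N k * (s / (2 + (gauss_node N k + 1) * s))) - ln (1 + s)\<bar>
           \<le> 4 * \<delta> ^ (2 * N + 1) / (1 - \<delta>)"
proof -
  define c where "c = s / (2 + s)"
  have s2: "2 + s > 1" using assms by linarith
  have cs: "\<bar>c\<bar> \<le> \<bar>s\<bar>"
    using s2 mult_left_mono[of 1 "2 + s" "\<bar>s\<bar>"] by (simp add: c_def abs_divide pos_divide_le_eq)
  have kernel: "s / (2 + (t + 1) * s) = c / (1 + c * t)" for t
  proof -
    have "1 + c * t = (2 + (t + 1) * s) / (2 + s)"
      using s2 by (simp add: c_def field_simps)
    then show ?thesis using s2 by (simp add: c_def)
  qed
  have "(1 + c) / (1 - c) = 1 + s"
    using s2 by (simp add: c_def field_simps)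
  then have I: "((\<lambda>t. c / (1 + c * t)) has_integral ln (1 + s)) {-1..1}"
    using has_integral_log_kernel[of c] cs assms by auto
  \<comment> \<open>Taking \<open>2 * N\<close> terms gives degree at most \<open>2 * N - 1\<close>,
    the limit of exactness.\<close>
  have "\<bar>(\<Sum>k=1..N. gauss_weight N k * (c / (1 + c * gauss_node N k))) -
      integral {-1..1} (\<lambda>t. c / (1 + c * t))\<bar> \<le> 4 * (\<delta> ^ Suc (2 * N) / (1 - \<delta>))"
    using cs assms I
    by (intro gauss_quadrature_error[where p = "log_kernel_poly (2 * N) c"]
          log_kernel_poly_error degree_log_kernel_poly) auto
  then show ?thesis
    using integral_unique[OF I] by (simp add: kernel)
qed

section \<open>The conic representation\<close>

text \<open>The rotated cone: \<open>(p + q)\<^sup>2 - (p - q)\<^sup>2 = 4 * p * q\<close>.\<close>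

lemma rotated_lorentz3_iff:
  assumes "p \<ge> 0" "q \<ge> 0"
  shows "(a, p - q, p + q) \<in> lorentz3 \<longleftrightarrow> a\<^sup>2 \<le> 4 * p * q"
proof -
  have "(a, p - q, p + q) \<in> lorentz3 \<longleftrightarrow> a\<^sup>2 + (p - q)\<^sup>2 \<le> (p + q)\<^sup>2"
    using assms by (auto simp: lorentz3_def intro: real_le_lsqrt dest: sqrt_le_D)
  then show ?thesis by (simp add: power2_eq_square algebra_simps)
qed

text \<open>The \<open>v\<^sup>2\<close> terms of \<open>4 r\<^sub>1 r\<^sub>2 \<ge> 8 (t + 1) v\<^sup>2\<close> cancel, leaving a linear condition on \<open>v\<close>.\<close>

lemma soc_phi_iff:
  assumes "t \<ge> -1" "1 - (t + 1) * v \<ge> 0" "s - 2 * v \<ge> 0"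
  shows "(v * sqrt (8 * (t + 1)), 1 - (t + 1) * v - (s - 2 * v), 1 - (t + 1) * v + (s - 2 * v)) \<in> lorentz3
           \<longleftrightarrow> v * (2 + (t + 1) * s) \<le> s"
proof -
  have sq: "(v * sqrt (8 * (t + 1)))\<^sup>2 = 8 * (t + 1) * v\<^sup>2"
    using assms by (simp add: power_mult_distrib)
  have "4 * (1 - (t + 1) * v) * (s - 2 * v) - 8 * (t + 1) * v\<^sup>2 = 4 * (s - v * (2 + (t + 1) * s))"
    by (simp add: power2_eq_square algebra_simps)
  moreover have "b \<le> a \<longleftrightarrow> d \<le> c" if "a - b = 4 * (c - d)" for a b c d :: real
    using that by auto
  ultimately show ?thesis
    unfolding rotated_lorentz3_iff[OF assms(2,3)] sq by blast
qed

text \<open>The slacks are functions of \<open>x\<close> and \<open>v\<close>. This form serves both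
  the description as a hypograph and the count of variables.\<close>

lemma H_hat_eliminate_slacks:
  "(x, \<nu>) \<in> H_hat M xh N \<longleftrightarrow> x \<in> {1/M..M} \<and> (\<exists>v.
     \<nu> - ln xh \<le> (\<Sum>k=1..N. gauss_weight N k * v k) \<and>
     (\<forall>k\<in>{1..N}. 0 \<le> 1 - (gauss_node N k + 1) * v k \<and> 0 \<le> x / xh - 1 - 2 * v k \<and>
        (v k * sqrt (8 * (gauss_node N k + 1)),
         1 - (gauss_node N k + 1) * v k - (x / xh - 1 - 2 * v k),
         1 - (gauss_node N k + 1) * v k + (x / xh - 1 - 2 * v k)) \<in> lorentz3))"
    (is "_ \<longleftrightarrow> _ \<and> (\<exists>v. _ \<and> (\<forall>k\<in>_. ?con v k))")
proof (intro iffI)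
  assume "(x, \<nu>) \<in> H_hat M xh N"
  then obtain v r1 r2 where x: "x \<in> {1/M..M}"
    and sum: "(\<Sum>k=1..N. gauss_weight N k * v k) \<ge> \<nu> - ln xh"
    and r: "\<forall>k\<in>{1..N}. r1 k = 1 - (gauss_node N k + 1) * v k \<and> r1 k \<ge> 0 \<and>
       r2 k = x / xh - 1 - 2 * v k \<and> r2 k \<ge> 0 \<and>
       (v k * sqrt (8 * (gauss_node N k + 1)), r1 k - r2 k, r1 k + r2 k) \<in> lorentz3"
    unfolding H_hat_def by blast
  have "?con v k" if "k \<in> {1..N}" for k
    using r[rule_format, OF that] by auto
  with x sum show "x \<in> {1/M..M} \<and> (\<exists>v. \<nu> - ln xh \<le> (\<Sum>k=1..N. gauss_weight N k * v k) \<and>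
      (\<forall>k\<in>{1..N}. ?con v k))" by blast
next
  assume R: "x \<in> {1/M..M} \<and> (\<exists>v. \<nu> - ln xh \<le> (\<Sum>k=1..N. gauss_weight N k * v k) \<and>
      (\<forall>k\<in>{1..N}. ?con v k))"
  then have x: "x \<in> {1/M..M}" ..
  from R obtain v where v: "\<nu> - ln xh \<le> (\<Sum>k=1..N. gauss_weight N k * v k)" "\<forall>k\<in>{1..N}. ?con v k"
    by blast
  show "(x, \<nu>) \<in> H_hat M xh N"
    unfolding H_hat_def mem_Collect_eq prod.case
    by (rule conjI, rule x, rule exI[of _ v], rule exI[of _ "\<lambda>k. 1 - (gauss_node N k + 1) * v k"],
        rule exI[of _ "\<lambda>k. x / xh - 1 - 2 * v k"]) (use v in blast)
qed

text \<open>The constraints force each \<open>v k\<close> below the value of the integrand at the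
  node, and that value is itself feasible. Since the weights are nonnegative, it is the best choice
  for the sum.\<close>

lemma H_hat_iff:
  assumes "M > 0" "xh > 0"
  shows "(x, \<nu>) \<in> H_hat M xh N \<longleftrightarrow> x \<in> {1/M..M} \<and>
    \<nu> - ln xh \<le> (\<Sum>k=1..N. gauss_weight N k *
      ((x / xh - 1) / (2 + (gauss_node N k + 1) * (x / xh - 1))))"
    (is "_ \<longleftrightarrow> _ \<and> _ \<le> (\<Sum>k=1..N. _ * ?\<phi> k)")
proof (cases "x \<in> {1/M..M}")
  case True
  define s where "s = x / xh - 1"
  have "x > 0" using True assms by (auto intro: less_le_trans[of 0 "1/M"])
  then have s: "s > -1" using assms by (simp add: s_def)
  have d: "2 + (gauss_node N k + 1) * s > 0" if "k \<in> {1..N}" for k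
  proof -
    \<comment> \<open>With \<open>t\<close> the node, the denominator equals
      \<open>(1 - t) + (t + 1) * (s + 1)\<close>, a sum of positive terms.\<close>
    have "(gauss_node N k + 1) * (s + 1) > 0"
      using gauss_node_bounds[OF that] s by simp
    then show ?thesis using gauss_node_bounds[OF that] by (simp add: algebra_simps)
  qed
  show ?thesis
  proof
    assume "(x, \<nu>) \<in> H_hat M xh N"
    then obtain v where sum: "\<nu> - ln xh \<le> (\<Sum>k=1..N. gauss_weight N k * v k)"
      and con: "\<forall>k\<in>{1..N}. 0 \<le> 1 - (gauss_node N k + 1) * v k \<and> 0 \<le> s - 2 * v k \<and>
         (v k * sqrt (8 * (gauss_node N k + 1)), 1 - (gauss_node N k + 1) * v k - (s - 2 * v k),
          1 - (gauss_node N k + 1) * v k + (s - 2 * v k)) \<in> lorentz3"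
      unfolding H_hat_eliminate_slacks s_def by blast
    have "v k \<le> ?\<phi> k" if k: "k \<in> {1..N}" for k
    proof -
      have "v k * (2 + (gauss_node N k + 1) * s) \<le> s"
        using con[rule_format, OF k] gauss_node_bounds[OF k]
        by (intro soc_phi_iff[THEN iffD1]) auto
      then show ?thesis using d[OF k] by (simp add: s_def pos_le_divide_eq)
    qed
    then have "(\<Sum>k=1..N. gauss_weight N k * v k) \<le> (\<Sum>k=1..N. gauss_weight N k * ?\<phi> k)"
      by (intro sum_mono mult_left_mono gauss_weight_nonneg)
    then show "x \<in> {1/M..M} \<and> \<nu> - ln xh \<le> (\<Sum>k=1..N. gauss_weight N k * ?\<phi> k)"
      using True sum by linarith
  next
    assume R: "x \<in> {1/M..M} \<and> \<nu> - ln xh \<le> (\<Sum>k=1..N. gauss_weight N k * ?\<phi> k)"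
    have "0 \<le> 1 - (gauss_node N k + 1) * ?\<phi> k \<and> 0 \<le> s - 2 * ?\<phi> k \<and>
        (?\<phi> k * sqrt (8 * (gauss_node N k + 1)), 1 - (gauss_node N k + 1) * ?\<phi> k - (s - 2 * ?\<phi> k),
         1 - (gauss_node N k + 1) * ?\<phi> k + (s - 2 * ?\<phi> k)) \<in> lorentz3" if k: "k \<in> {1..N}" for k
    proof -
      let ?d = "2 + (gauss_node N k + 1) * s"
      \<comment> \<open>Closed forms of the two slacks at the optimum, from which their signs are
        visible.\<close>
      have "1 - (gauss_node N k + 1) * ?\<phi> k = 2 / ?d" "s - 2 * ?\<phi> k = (gauss_node N k + 1) * s\<^sup>2 / ?d"
        using d[OF k] by (simp_all flip: s_def add: field_simps power2_eq_square)
      then have "0 \<le> 1 - (gauss_node N k + 1) * ?\<phi> k" "0 \<le> s - 2 * ?\<phi> k"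
        using d[OF k] gauss_node_bounds[OF k] by simp_all
      moreover have "?\<phi> k * ?d \<le> s" using d[OF k] by (simp flip: s_def)
      ultimately show ?thesis
        using soc_phi_iff[of "gauss_node N k" "?\<phi> k" s] gauss_node_bounds[OF k] by auto
    qed
    then show "(x, \<nu>) \<in> H_hat M xh N"
      using R unfolding H_hat_eliminate_slacks s_def by (intro conjI exI[of _ ?\<phi>] ballI) blast+
  qed
qed (auto simp: H_hat_def)

lemma H_hat_sandwich:
  assumes "M > 1" "xh \<in> {1/M..M}" "\<delta> \<in> {0<..<1}" "N \<ge> 1"
    and \<epsilon>: "4 * \<delta> ^ (2 * N + 1) / (1 - \<delta>) \<le> \<epsilon>"
  shows "hyp_log M (-\<epsilon>) \<inter> dom_near M xh \<delta> \<times> UNIV \<subseteq> H_hat M xh N \<inter> dom_near M xh \<delta> \<times> UNIV"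
    and "H_hat M xh N \<inter> dom_near M xh \<delta> \<times> UNIV \<subseteq> hyp_log M \<epsilon> \<inter> dom_near M xh \<delta> \<times> UNIV"
proof -
  have M: "M > 0" using assms by simp
  have xh: "xh > 0" using assms by (auto intro: less_le_trans[of 0 "1/M"])
  have err: "\<bar>(\<Sum>k=1..N. gauss_weight N k *
      ((x / xh - 1) / (2 + (gauss_node N k + 1) * (x / xh - 1)))) - (ln x - ln xh)\<bar> \<le> \<epsilon>"
    if x: "x \<in> dom_near M xh \<delta>" for x
  proof -
    have "x > 0" using x M by (auto simp: dom_near_def intro: less_le_trans[of 0 "1/M"])
    then have "ln x - ln xh = ln (1 + (x / xh - 1))" using xh by (simp add: ln_div)
    moreover have "\<bar>x / xh - 1\<bar> \<le> \<delta>" using x by (auto simp: dom_near_def)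
    ultimately show ?thesis
      using gauss_log_error[of N "x / xh - 1" \<delta>] assms by (simp only:) auto
  qed
  show "hyp_log M (-\<epsilon>) \<inter> dom_near M xh \<delta> \<times> UNIV \<subseteq> H_hat M xh N \<inter> dom_near M xh \<delta> \<times> UNIV"
    using err unfolding hyp_log_def by (auto simp: H_hat_iff[OF M xh] abs_le_iff; smt (verit))
  show "H_hat M xh N \<inter> dom_near M xh \<delta> \<times> UNIV \<subseteq> hyp_log M \<epsilon> \<inter> dom_near M xh \<delta> \<times> UNIV"
    using err unfolding hyp_log_def by (auto simp: H_hat_iff[OF M xh] abs_le_iff; smt (verit))
qed

section \<open>Encoding as a list of cone constraints\<close>

text \<open>Apart from the quadrature inequality, a constraint involves only \<open>x\<close> at
  index 0 and one \<open>v k\<close> at index \<open>Suc k\<close>. The bounds on \<open>x\<close>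
  use \<open>k = 0\<close> with \<open>b = 0\<close>, as index 1 belongs to \<nu>.\<close>

definition two_term_form :: "nat \<Rightarrow> real \<Rightarrow> real \<Rightarrow> real \<Rightarrow> affine_form" where
  "two_term_form k a b c = (\<lambda>i. (if i = 0 then a else 0) + (if i = Suc k then b else 0), c)"

lemma affine_val_two_term_form:
  assumes "Suc k < n"
  shows "affine_val n (two_term_form k a b c) y = a * y 0 + b * y (Suc k) + c"
proof -
  have "affine_val n (two_term_form k a b c) y =
      (\<Sum>i<n. (if i = 0 then a * y i else 0) + (if i = Suc k then b * y i else 0)) + c"
    unfolding affine_val_def two_term_form_def fst_conv snd_conv
    by (intro arg_cong2[where f = "(+)"] sum.cong) auto
  then show ?thesis using assms by (simp add: sum.distrib)
qed

definition quadrature_form :: "nat \<Rightarrow> real \<Rightarrow> affine_form" where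
  "quadrature_form N c = (\<lambda>i. if i = 0 then 0 else if i = 1 then -1 else gauss_weight N (i - 1), c)"

lemma affine_val_quadrature_form:
  "affine_val (N + 2) (quadrature_form N c) y = (\<Sum>k=1..N. gauss_weight N k * y (Suc k)) - y 1 + c"
  by (simp add: affine_val_def quadrature_form_def sum.lessThan_Suc_shift sum.atLeast1_atMost_eq
      del: sum.lessThan_Suc)

text \<open>The variables are \<open>x\<close>, \<open>\<nu>\<close> and \<open>v\<^sub>1, \<dots>, v\<^sub>N\<close>, with \<open>v\<^sub>k\<close> at index \<open>k + 1\<close>; the slacks
  \<open>r\<^sub>1\<^sub>k\<close>, \<open>r\<^sub>2\<^sub>k\<close> are affine in these and are eliminated.\<close>

lemma soc_represented_H_hat: "soc_represented (H_hat M xh N) (N + 2) (3 * N + 3)"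
proof -
  let ?t = "\<lambda>k. gauss_node N k + 1"
  let ?r1 = "\<lambda>k. two_term_form k 0 (- ?t k) 1"
  let ?r2 = "\<lambda>k. two_term_form k (1 / xh) (- 2) (- 1)"
  \<comment> \<open>The last two forms are the difference and the sum of \<open>?r1 k\<close> and
    \<open>?r2 k\<close>, with coefficients collected.\<close>
  let ?soc = "\<lambda>k. Soc (two_term_form k 0 (sqrt (8 * ?t k)) 0)
      (two_term_form k (- (1 / xh)) (2 - ?t k) 2) (two_term_form k (1 / xh) (- ?t k - 2) 0)"
  define cs where "cs = [Lin_ge (two_term_form 0 1 0 (- (1 / M))), Lin_ge (two_term_form 0 (- 1) 0 M),
      Lin_ge (quadrature_form N (ln xh))] @ map (\<lambda>k. Lin_ge (?r1 k)) [1..<Suc N]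
      @ map (\<lambda>k. Lin_ge (?r2 k)) [1..<Suc N] @ map ?soc [1..<Suc N]"
  have sat: "(\<forall>c\<in>set cs. satisfies (N + 2) y c) \<longleftrightarrow>
      y 0 \<in> {1/M..M} \<and> (\<Sum>k=1..N. gauss_weight N k * y (Suc k)) \<ge> y 1 - ln xh \<and>
      (\<forall>k\<in>{1..N}. 1 - ?t k * y (Suc k) \<ge> 0 \<and> y 0 / xh - 1 - 2 * y (Suc k) \<ge> 0 \<and>
         (y (Suc k) * sqrt (8 * ?t k), 1 - ?t k * y (Suc k) - (y 0 / xh - 1 - 2 * y (Suc k)),
          1 - ?t k * y (Suc k) + (y 0 / xh - 1 - 2 * y (Suc k))) \<in> lorentz3)" for y
  proof -
    have r1: "affine_val (N + 2) (?r1 k) y = 1 - ?t k * y (Suc k)"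
      and r2: "affine_val (N + 2) (?r2 k) y = y 0 / xh - 1 - 2 * y (Suc k)"
      and f: "affine_val (N + 2) (two_term_form k 0 (sqrt (8 * ?t k)) 0) y = y (Suc k) * sqrt (8 * ?t k)"
      and g: "affine_val (N + 2) (two_term_form k (- (1 / xh)) (2 - ?t k) 2) y =
        1 - ?t k * y (Suc k) - (y 0 / xh - 1 - 2 * y (Suc k))"
      and h: "affine_val (N + 2) (two_term_form k (1 / xh) (- ?t k - 2) 0) y =
        1 - ?t k * y (Suc k) + (y 0 / xh - 1 - 2 * y (Suc k))"
      if "k \<in> {1..N}" for k
      using that by (simp_all add: affine_val_two_term_form algebra_simps)
    have lo: "affine_val (N + 2) (two_term_form 0 1 0 (- (1 / M))) y = y 0 - 1 / M"
      and hi: "affine_val (N + 2) (two_term_form 0 (- 1) 0 M) y = M - y 0"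
      by (simp_all add: affine_val_two_term_form)
    have setk: "set [1..<Suc N] = {1..N}" by auto
    have "(\<forall>c\<in>set cs. satisfies (N + 2) y c) \<longleftrightarrow>
        0 \<le> y 0 - 1 / M \<and> 0 \<le> M - y 0 \<and>
        0 \<le> (\<Sum>k=1..N. gauss_weight N k * y (Suc k)) - y 1 + ln xh \<and>
        (\<forall>k\<in>{1..N}. satisfies (N + 2) y (Lin_ge (?r1 k))) \<and>
        (\<forall>k\<in>{1..N}. satisfies (N + 2) y (Lin_ge (?r2 k))) \<and>
        (\<forall>k\<in>{1..N}. satisfies (N + 2) y (?soc k))"
      by (simp only: cs_def set_append list.set set_map setk ball_Un ball_simps simp_thms conj_assoc
          satisfies.simps lo hi affine_val_quadrature_form)
    also have "\<dots> \<longleftrightarrow> 0 \<le> y 0 - 1 / M \<and> 0 \<le> M - y 0 \<and>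
        0 \<le> (\<Sum>k=1..N. gauss_weight N k * y (Suc k)) - y 1 + ln xh \<and>
        (\<forall>k\<in>{1..N}. 1 - ?t k * y (Suc k) \<ge> 0 \<and> y 0 / xh - 1 - 2 * y (Suc k) \<ge> 0 \<and>
         (y (Suc k) * sqrt (8 * ?t k), 1 - ?t k * y (Suc k) - (y 0 / xh - 1 - 2 * y (Suc k)),
          1 - ?t k * y (Suc k) + (y 0 / xh - 1 - 2 * y (Suc k))) \<in> lorentz3)"
      unfolding ball_conj_distrib by (simp only: satisfies.simps r1 r2 f g h cong: ball_cong)
    finally show ?thesis by auto
  qed
  have "H_hat M xh N = {(x, \<nu>). \<exists>y. y 0 = x \<and> y 1 = \<nu> \<and> (\<forall>c\<in>set cs. satisfies (N + 2) y c)}"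
  proof (intro set_eqI iffI; clarify)
    fix x \<nu> assume "(x, \<nu>) \<in> H_hat M xh N"
    then obtain v where v: "x \<in> {1/M..M}" "\<nu> - ln xh \<le> (\<Sum>k=1..N. gauss_weight N k * v k)"
      "\<forall>k\<in>{1..N}. 1 - ?t k * v k \<ge> 0 \<and> x / xh - 1 - 2 * v k \<ge> 0 \<and>
        (v k * sqrt (8 * ?t k), 1 - ?t k * v k - (x / xh - 1 - 2 * v k),
         1 - ?t k * v k + (x / xh - 1 - 2 * v k)) \<in> lorentz3"
      unfolding H_hat_eliminate_slacks by blast
    define y where "y = (\<lambda>i. if i = 0 then x else if i = 1 then \<nu> else v (i - 1))"
    have y: "y 0 = x" "y 1 = \<nu>" "\<And>k. k \<in> {1..N} \<Longrightarrow> y (Suc k) = v k"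
      by (auto simp: y_def)
    have "\<forall>c\<in>set cs. satisfies (N + 2) y c"
      unfolding sat
    proof (intro conjI ballI)
      show "y 1 - ln xh \<le> (\<Sum>k=1..N. gauss_weight N k * y (Suc k))"
        using v(2) by (simp only: y cong: sum.cong)
    qed (use v(1,3) in \<open>simp_all only: y\<close>)
    then show "\<exists>y. y 0 = x \<and> y 1 = \<nu> \<and> (\<forall>c\<in>set cs. satisfies (N + 2) y c)"
      using y by blast
  next
    fix y :: "nat \<Rightarrow> real" assume "\<forall>c\<in>set cs. satisfies (N + 2) y c"
    then show "(y 0, y 1) \<in> H_hat M xh N"
      unfolding sat H_hat_eliminate_slacks by (intro conjI exI[of _ "\<lambda>k. y (Suc k)"] ballI) blast+
  qed
  moreover have "length cs = 3 * N + 3" by (simp add: cs_def)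
  ultimately show ?thesis unfolding soc_represented_def by auto
qed

section \<open>The bound on the Bernstein ellipse and the size estimate\<close>

text \<open>On the ellipse \<open>cmod z\<close> is at most the major semi-axis \<open>R\<close>,
  and \<open>phi3_bound \<delta>\<close> is \<open>1 / (rho \<delta> - R)\<close>. The reverse
  triangle inequality bounds the denominator below by
  \<open>2 - \<bar>s\<bar> - \<bar>s\<bar> * R\<close>, which is at least
  \<open>\<bar>s\<bar> * (rho \<delta> - R)\<close> because
  \<open>\<bar>s\<bar> \<le> \<delta> = 2 / (rho \<delta> + 1)\<close>.\<close>

lemma phi3_ellipse_bound:
  assumes "\<delta> \<in> {0<..<1}" "x \<in> dom_near M xh \<delta>"
    and z: "z = of_real (rho \<delta> / 2) * exp (\<i> * of_real \<theta>)
            + of_real (inverse (rho \<delta>) / 2) * exp (- \<i> * of_real \<theta>)"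
  shows "phi3_denom xh z x \<noteq> 0 \<and> cmod (phi3 xh z x) \<le> phi3_bound \<delta>"
proof -
  define s where "s = x / xh - 1"
  define R where "R = rho \<delta> / 2 + inverse (rho \<delta>) / 2"
  have s: "\<bar>s\<bar> \<le> \<delta>" using assms by (auto simp: dom_near_def s_def)
  have \<rho>: "rho \<delta> > 1" "rho \<delta> + 1 = 2 / \<delta>" using assms by (auto simp: rho_def field_simps)
  have "inverse (rho \<delta>) < 1" using \<rho> by (simp add: inverse_less_1_iff)
  then have B: "rho \<delta> - R > 0" using \<rho> by (simp add: R_def)
  have bound: "phi3_bound \<delta> = 1 / (rho \<delta> - R)"
    by (simp add: phi3_bound_def R_def rho_def inverse_eq_divide algebra_simps)
  have "cmod z \<le> R"
    unfolding z R_def using \<rho> by (intro order_trans[OF norm_triangle_ineq]) (simp add: norm_mult norm_inverse)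
  then have "cmod (of_real s * z) \<le> \<bar>s\<bar> * R"
    by (simp add: norm_mult mult_left_mono)
  moreover have den: "phi3_denom xh z x = of_real (2 + s) + of_real s * z"
    unfolding phi3_denom_def s_def[symmetric] by (simp add: algebra_simps)
  moreover have "cmod (of_real (2 + s)) \<ge> 2 - \<bar>s\<bar>"
    unfolding norm_of_real by linarith
  ultimately have low: "cmod (phi3_denom xh z x) \<ge> 2 - \<bar>s\<bar> - \<bar>s\<bar> * R"
    using norm_diff_ineq[of "of_real (2 + s)" "of_real s * z"] by simp
  have "\<bar>s\<bar> * (rho \<delta> + 1) \<le> 2" using s assms(1) by (simp add: \<rho>(2) pos_divide_le_eq)
  then have key: "\<bar>s\<bar> * (rho \<delta> - R) \<le> cmod (phi3_denom xh z x)"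
    using low by (simp add: algebra_simps)
  have pos: "cmod (phi3_denom xh z x) > 0"
  \<comment> \<open>At \<open>s = 0\<close> the estimate \<open>key\<close> gives only
    nonnegativity, but there the denominator is 2.\<close>
  proof (cases "s = 0")
    case True
    then show ?thesis by (simp add: den)
  next
    case False
    then have "0 < \<bar>s\<bar> * (rho \<delta> - R)" using B by simp
    then show ?thesis using key by linarith
  qed
  have "cmod (phi3 xh z x) = \<bar>s\<bar> / cmod (phi3_denom xh z x)"
    unfolding phi3_def s_def by (simp add: norm_divide flip: of_real_diff)
  also have "\<dots> \<le> phi3_bound \<delta>"
    using key pos B by (simp add: bound field_simps)
  finally show ?thesis using pos by auto
qed

section \<open>Choice of the number of points\<close>

text \<open>Dividing \<epsilon> by 4 absorbs the constant of the quadrature error. The maximum keeps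
  at least one node when \<epsilon> is so large that the rate is not positive.\<close>

definition num_points :: "real \<Rightarrow> real \<Rightarrow> nat" where
  "num_points \<delta> \<epsilon> = max 1 (nat \<lceil>size_rate \<delta> (\<epsilon> / 4)\<rceil>)"

lemma num_points_error:
  assumes "\<delta> \<in> {0<..<1}" "\<epsilon> > 0"
  shows "4 * \<delta> ^ (2 * num_points \<delta> \<epsilon> + 1) / (1 - \<delta>) \<le> \<epsilon>"
proof -
  let ?N = "num_points \<delta> \<epsilon>"
  have "size_rate \<delta> (\<epsilon> / 4) \<le> real ?N"
    unfolding num_points_def by linarith
  then have "real ?N * ln \<delta> \<le> size_rate \<delta> (\<epsilon> / 4) * ln \<delta>"
    using assms by (intro mult_right_mono_neg) auto
  also have "\<dots> = ln ((1 - \<delta>) * (\<epsilon> / 4))"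
    using assms ln_mult[of "1 - \<delta>" "\<epsilon> / 4"] by (simp add: size_rate_def flip: add_divide_distrib)
  finally have "ln (\<delta> ^ ?N) \<le> ln ((1 - \<delta>) * (\<epsilon> / 4))"
    using assms by (simp add: ln_realpow)
  then have "\<delta> ^ ?N \<le> (1 - \<delta>) * (\<epsilon> / 4)"
    using assms by (subst (asm) ln_le_cancel_iff) auto
  \<comment> \<open>The doubled exponent is given away; it affects only the constant in the
    rate.\<close>
  moreover have "\<delta> ^ (2 * ?N + 1) \<le> \<delta> ^ ?N"
    using assms by (intro power_decreasing) auto
  ultimately show ?thesis using assms by (simp add: field_simps)
qed

text \<open>For \<open>\<epsilon> < 1 / 4\<close> the extra term \<open>- ln 4 / ln \<delta>\<close>
  is at most \<open>ln \<epsilon> / ln \<delta>\<close>, which doubles the rate at worst; rounding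
  up adds at most 1, hence the factor 3.\<close>

lemma num_points_le:
  assumes "\<delta> \<in> {0<..<1}" "0 < \<epsilon>" "\<epsilon> < 1 / 4"
  shows "real (num_points \<delta> \<epsilon>) \<le> 3 * max 1 (size_rate \<delta> \<epsilon>)"
proof -
  have "ln \<epsilon> \<le> ln (1 / 4)" using assms by (subst ln_le_cancel_iff) auto
  then have "ln \<epsilon> \<le> - ln 4" by (simp add: ln_div)
  then have "- ln 4 / ln \<delta> \<le> ln \<epsilon> / ln \<delta>"
    using assms by (intro divide_right_mono_neg) auto
  moreover have "0 \<le> ln (1 - \<delta>) / ln \<delta>"
    using assms by (intro divide_nonpos_nonpos) auto
  moreover have "size_rate \<delta> (\<epsilon> / 4) = size_rate \<delta> \<epsilon> + (- ln 4 / ln \<delta>)"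
    using assms by (simp add: size_rate_def ln_div diff_divide_distrib)
  ultimately have "size_rate \<delta> (\<epsilon> / 4) \<le> 2 * size_rate \<delta> \<epsilon>"
    by (simp add: size_rate_def)
  then show ?thesis
    unfolding num_points_def by linarith
qed

lemma size_rate_ge_1:
  assumes "\<delta> \<in> {0<..<1}" "0 < \<epsilon>" "\<epsilon> < \<delta>"
  shows "size_rate \<delta> \<epsilon> \<ge> 1"
proof -
  have "ln \<epsilon> \<le> ln \<delta>" using assms by (subst ln_le_cancel_iff) auto
  then have "ln \<delta> / ln \<delta> \<le> ln \<epsilon> / ln \<delta>"
    using assms by (intro divide_right_mono_neg) auto
  moreover have "0 \<le> ln (1 - \<delta>) / ln \<delta>"
    using assms by (intro divide_nonpos_nonpos) auto
  moreover have "ln \<delta> / ln \<delta> = 1" using assms by simp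
  ultimately show ?thesis unfolding size_rate_def by linarith
qed

text \<open>For fixed \<delta> and \<epsilon> below \<delta> the rate is at least 1, so the maximum
  drops out of the assumed bound.\<close>

lemma size_rate_bigo:
  assumes "\<delta> \<in> {0<..<1}"
    and f: "\<And>\<epsilon>. 0 < \<epsilon> \<Longrightarrow> \<epsilon> < b \<Longrightarrow> real (f \<epsilon>) \<le> C * max 1 (size_rate \<delta> \<epsilon>)" and "b > 0"
  shows "(\<lambda>\<epsilon>. real (f \<epsilon>)) \<in> O[at_right 0](size_rate \<delta>)"
proof (rule bigoI[where c = C])
  have "eventually (\<lambda>\<epsilon>. \<epsilon> \<in> {0<..<min b \<delta>}) (at_right 0)"
    using assms by (intro eventually_at_right_real) auto
  then show "eventually (\<lambda>\<epsilon>. norm (real (f \<epsilon>)) \<le> C * norm (size_rate \<delta> \<epsilon>)) (at_right 0)"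
  proof eventually_elim
    case (elim \<epsilon>)
    then show ?case using f[of \<epsilon>] size_rate_ge_1[OF assms(1), of \<epsilon>] by (simp add: max_def)
  qed
qed

text \<open>\<open>C\<close> and \<open>\<epsilon>0\<close> precede \<open>M\<close>,
  \<open>xh\<close> and \<delta>, so the explicit bound is uniform in them; there
  \<open>max 1\<close> covers rates below 1. The denominator is asserted to be nonzero because
  division by zero yields 0 and would make the bound hold at a pole.\<close>

theorem corollary3:
  "\<exists>C>0. \<exists>\<epsilon>0>0. \<forall>M xh \<delta> :: real. 1 < M \<longrightarrow> xh \<in> {1/M..M} \<longrightarrow> \<delta> \<in> {0<..<1} \<longrightarrow>
     (\<forall>x\<in>dom_near M xh \<delta>. \<forall>\<theta>\<in>{0..2*pi}. \<forall>z.
        z = of_real (rho \<delta> / 2) * exp (\<i> * of_real \<theta>)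
            + of_real (inverse (rho \<delta>) / 2) * exp (- \<i> * of_real \<theta>) \<longrightarrow>
        phi3_denom xh z x \<noteq> 0 \<and> cmod (phi3 xh z x) \<le> phi3_bound \<delta>) \<and>
     (\<exists>N nvars ncons :: real \<Rightarrow> nat.
        (\<forall>\<epsilon>>0. N \<epsilon> \<ge> 1 \<and>
           hyp_log M (-\<epsilon>) \<inter> dom_near M xh \<delta> \<times> UNIV
             \<subseteq> H_hat M xh (N \<epsilon>) \<inter> dom_near M xh \<delta> \<times> UNIV \<and>
           H_hat M xh (N \<epsilon>) \<inter> dom_near M xh \<delta> \<times> UNIV
             \<subseteq> hyp_log M \<epsilon> \<inter> dom_near M xh \<delta> \<times> UNIV \<and>
           soc_represented (H_hat M xh (N \<epsilon>)) (nvars \<epsilon>) (ncons \<epsilon>)) \<and>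
        (\<forall>f\<in>{N, nvars, ncons}.
           (\<lambda>\<epsilon>. real (f \<epsilon>)) \<in> O[at_right 0](size_rate \<delta>) \<and>
           (\<forall>\<epsilon>. 0 < \<epsilon> \<and> \<epsilon> < \<epsilon>0 \<longrightarrow> real (f \<epsilon>) \<le> C * max 1 (size_rate \<delta> \<epsilon>))))"
proof (rule exI[of _ 12], rule conjI, simp, rule exI[of _ "1/4"], rule conjI, simp,
    intro allI impI)
  fix M xh \<delta> :: real
  assume M: "1 < M" and xh: "xh \<in> {1/M..M}" and \<delta>: "\<delta> \<in> {0<..<1}"
  let ?N = "num_points \<delta>"
  let ?nvars = "\<lambda>\<epsilon>. ?N \<epsilon> + 2"
  let ?ncons = "\<lambda>\<epsilon>. 3 * ?N \<epsilon> + 3"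
  \<comment> \<open>The constraint count is the largest: with
    \<open>m = max 1 (size_rate \<delta> \<epsilon>)\<close> it is at most
    \<open>3 * (3 * m) + 3 \<le> 12 * m\<close>.\<close>
  have size: "real (f \<epsilon>) \<le> 12 * max 1 (size_rate \<delta> \<epsilon>)"
    if "f \<in> {?N, ?nvars, ?ncons}" "0 < \<epsilon>" "\<epsilon> < 1 / 4" for f \<epsilon>
    using num_points_le[OF \<delta> that(2,3)] that(1) by auto
  have N1: "?N \<epsilon> \<ge> 1" for \<epsilon>
    by (simp add: num_points_def)
  show "(\<forall>x\<in>dom_near M xh \<delta>. \<forall>\<theta>\<in>{0..2*pi}. \<forall>z.
        z = of_real (rho \<delta> / 2) * exp (\<i> * of_real \<theta>)
            + of_real (inverse (rho \<delta>) / 2) * exp (- \<i> * of_real \<theta>) \<longrightarrow>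
        phi3_denom xh z x \<noteq> 0 \<and> cmod (phi3 xh z x) \<le> phi3_bound \<delta>) \<and>
     (\<exists>N nvars ncons :: real \<Rightarrow> nat.
        (\<forall>\<epsilon>>0. N \<epsilon> \<ge> 1 \<and>
           hyp_log M (-\<epsilon>) \<inter> dom_near M xh \<delta> \<times> UNIV
             \<subseteq> H_hat M xh (N \<epsilon>) \<inter> dom_near M xh \<delta> \<times> UNIV \<and>
           H_hat M xh (N \<epsilon>) \<inter> dom_near M xh \<delta> \<times> UNIV
             \<subseteq> hyp_log M \<epsilon> \<inter> dom_near M xh \<delta> \<times> UNIV \<and>
           soc_represented (H_hat M xh (N \<epsilon>)) (nvars \<epsilon>) (ncons \<epsilon>)) \<and>
        (\<forall>f\<in>{N, nvars, ncons}.
           (\<lambda>\<epsilon>. real (f \<epsilon>)) \<in> O[at_right 0](size_rate \<delta>) \<and>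
           (\<forall>\<epsilon>. 0 < \<epsilon> \<and> \<epsilon> < 1/4 \<longrightarrow> real (f \<epsilon>) \<le> 12 * max 1 (size_rate \<delta> \<epsilon>))))"
  proof (rule conjI, intro ballI allI impI, rule phi3_ellipse_bound[OF \<delta>], assumption, assumption,
      rule exI[of _ ?N],
      rule exI[of _ ?nvars], rule exI[of _ ?ncons], intro conjI ballI allI impI)
    fix f assume "f \<in> {?N, ?nvars, ?ncons}"
    then show "(\<lambda>\<epsilon>. real (f \<epsilon>)) \<in> O[at_right 0](size_rate \<delta>)"
      by (intro size_rate_bigo[OF \<delta>, where b = "1/4" and C = 12] size) auto
  next
    fix f \<epsilon> assume "f \<in> {?N, ?nvars, ?ncons}" "0 < \<epsilon> \<and> \<epsilon> < 1 / (4::real)"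
    then show "real (f \<epsilon>) \<le> 12 * max 1 (size_rate \<delta> \<epsilon>)"
      using size by blast
  qed (use N1 soc_represented_H_hat
      H_hat_sandwich[OF M xh \<delta> N1 num_points_error[OF \<delta>]] in \<open>auto simp only:\<close>)
qed

end
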